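(* Let $X$ be a locally compact metrizable topological space with a fixed compatible metric $d$, and let $\mathcal F=\{f_1,\dots,f_m\}$ be an iterated function system on $X$ with compact dynamics and global attractor $\mathcal G_{\mathcal F}$. Then the chain-recurrent set, the chain nodes and the chain graph of $\mathcal F$ coincide with those of the restriction $\mathcal F|_{\mathcal G_{\mathcal F}}=\{f_1|_{\mathcal G_{\mathcal F}},\dots,f_m|_{\mathcal G_{\mathcal F}}\}$, regarded as an iterated function system on the metric space $(\mathcal G_{\mathcal F},d)$.
   Context: An iterated function system (IFS) on $X$ is a finite collection $\mathcal F=\{f_1,\dots,f_m\}$, $m\ge 1$, of continuous maps $f_i:X\to X$. For a finite word $I=i_1\dots i_k$ ($k\ge 0$) in the alphabet $\{1,\dots,m\}$, $|I|=k$ and $\Phi^I_{\mathcal F}=f_{i_1}\circ\dots\circ f_{i_k}$ (the identity for the empty word). The orbit of $x$ is $\mathcal O_{\mathcal F}(x)=\{\Phi^I_{\mathcal F}(x): I \text{ a finite word}\}$, which contains $x$. Put $H_{\mathcal F}(A)=\bigcup_{i=1}^m f_i(A)$; $A\subset X$ is $H$-invariant if $H_{\mathcal F}(A)=A$. With $N_\varepsilon(A)=\{x: d(x,A)<\varepsilon\}$, $A$ attracts $K$ if for every $\varepsilon>0$ there is $\tau>0$ such that $\Phi^I_{\mathcal F}(K)\subset N_\varepsilon(A)$ for every word $I$ with $|I|\ge\tau$. A global attractor of $\mathcal F$ is a non-empty compact $H$-invariant set that attracts every compact subset of $X$; it is unique when it exists and is denoted $\mathcal G_{\mathcal F}$.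 $\mathcal F$ has compact dynamics if it has a global attractor. Chains. For $\varepsilon>0$, an $\varepsilon$-chain from $x$ to $y$ is a finite sequence $x=x_0,x_1,\dots,x_k=y$ of points of $X$ ($k\ge 0$) together with indices $i_0,\dots,i_{k-1}\in\{1,\dots,m\}$ such that $d(f_{i_n}(x_n),x_{n+1})<\varepsilon$ for $n=0,\dots,k-1$. The point $y$ is downstream from $x$ if for every $\varepsilon>0$ there is an $\varepsilon$-chain from $x$ to $y$. Two points are chain-equivalent if each is downstream from the other. The chain-recurrent set is the set of $x\in X$ such that $x$ is chain-equivalent to $z$ for every $z\in\mathcal O_{\mathcal F}(x)$. Chain-equivalence is an equivalence relation on the chain-recurrent set; its equivalence classes are the chain nodes. For distinct chain nodes $M,N$ there is a chain edge from $M$ to $N$ if some point of $N$ is downstream from some point of $M$. The chain graph is the directed graph with the chain nodes as vertices and the chain edges as edges. *)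

theory Defs
  imports "HOL-Analysis.Analysis" "Graph_Theory.Pair_Digraph"
begin

text \<open>
  The phase space is an arbitrary subset \<open>X\<close> of a type of class \<open>metric_space\<close>, with the induced
  metric; \<open>X = UNIV\<close> is allowed, so every metric space is covered. The carrier is explicit because
  the same notions are applied to the global attractor as a phase space of its own. An iterated
  function system is given by its number \<open>m\<close> of maps and the family \<open>f\<close>, of which only the
  \<open>f i\<close> with \<open>i \<in> {1..m}\<close>, and only their values on the carrier, matter.
\<close>

definition ifs :: "'a::metric_space set \<Rightarrow> nat \<Rightarrow> (nat \<Rightarrow> 'a \<Rightarrow> 'a) \<Rightarrow> bool" where
  "ifs X m f \<longleftrightarrow> 1 \<le> m \<and> (\<forall>i\<in>{1..m}. continuous_on X (f i) \<and> f i ` X \<subseteq> X)"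

definition words :: "nat \<Rightarrow> nat list set" where
  "words m = lists {1..m}"

text \<open>\<open>foldr f [i\<^sub>1, \<dots>, i\<^sub>k] x = f i\<^sub>1 (\<dots> (f i\<^sub>k x))\<close>, so the last letter acts first.\<close>

definition word_map :: "(nat \<Rightarrow> 'a \<Rightarrow> 'a) \<Rightarrow> nat list \<Rightarrow> 'a \<Rightarrow> 'a" where
  "word_map f I = foldr f I"

definition orbit :: "nat \<Rightarrow> (nat \<Rightarrow> 'a \<Rightarrow> 'a) \<Rightarrow> 'a \<Rightarrow> 'a set" where
  "orbit m f x = {word_map f I x | I. I \<in> words m}"

definition hutchinson :: "nat \<Rightarrow> (nat \<Rightarrow> 'a \<Rightarrow> 'a) \<Rightarrow> 'a set \<Rightarrow> 'a set" where
  "hutchinson m f A = (\<Union>i\<in>{1..m}. f i ` A)"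

text \<open>
  \<open>infdist x {} = 0\<close> in the library, hence the explicit non-emptiness condition
  (the distance to the empty set is \<open>\<infinity>\<close>).
\<close>

definition nbhd :: "'a::metric_space set \<Rightarrow> real \<Rightarrow> 'a set \<Rightarrow> 'a set" where
  "nbhd X \<epsilon> A = {x \<in> X. A \<noteq> {} \<and> infdist x A < \<epsilon>}"

definition attracts ::
  "'a::metric_space set \<Rightarrow> nat \<Rightarrow> (nat \<Rightarrow> 'a \<Rightarrow> 'a) \<Rightarrow> 'a set \<Rightarrow> 'a set \<Rightarrow> bool" where
  "attracts X m f A K \<longleftrightarrow>
     (\<forall>\<epsilon>>0. \<exists>\<tau>>0. \<forall>I\<in>words m. \<tau> \<le> length I \<longrightarrow> word_map f I ` K \<subseteq> nbhd X \<epsilon> A)"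

definition is_global_attractor ::
  "'a::metric_space set \<Rightarrow> nat \<Rightarrow> (nat \<Rightarrow> 'a \<Rightarrow> 'a) \<Rightarrow> 'a set \<Rightarrow> bool" where
  "is_global_attractor X m f A \<longleftrightarrow>
     A \<subseteq> X \<and> A \<noteq> {} \<and> compact A \<and> hutchinson m f A = A \<and>
     (\<forall>K. K \<subseteq> X \<and> compact K \<longrightarrow> attracts X m f A K)"

definition compact_dynamics ::
  "'a::metric_space set \<Rightarrow> nat \<Rightarrow> (nat \<Rightarrow> 'a \<Rightarrow> 'a) \<Rightarrow> bool" where
  "compact_dynamics X m f \<longleftrightarrow> (\<exists>A. is_global_attractor X m f A)"

definition global_attractor ::
  "'a::metric_space set \<Rightarrow> nat \<Rightarrow> (nat \<Rightarrow> 'a \<Rightarrow> 'a) \<Rightarrow> 'a set" where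
  "global_attractor X m f = (THE A. is_global_attractor X m f A)"

definition ifs_restrict :: "(nat \<Rightarrow> 'a \<Rightarrow> 'a) \<Rightarrow> 'a set \<Rightarrow> nat \<Rightarrow> 'a \<Rightarrow> 'a" where
  "ifs_restrict f A = (\<lambda>i. restrict (f i) A)"

definition eps_chain ::
  "'a::metric_space set \<Rightarrow> nat \<Rightarrow> (nat \<Rightarrow> 'a \<Rightarrow> 'a) \<Rightarrow> real \<Rightarrow> 'a \<Rightarrow> 'a \<Rightarrow> bool" where
  "eps_chain X m f \<epsilon> x y \<longleftrightarrow>
     (\<exists>k xs js. xs 0 = x \<and> xs k = y \<and> (\<forall>n\<le>k. xs n \<in> X) \<and>
        (\<forall>n<k. js n \<in> {1..m} \<and> dist (f (js n) (xs n)) (xs (Suc n)) < \<epsilon>))"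

text \<open>\<open>downstream X m f x y\<close>: the point \<open>y\<close> is downstream from \<open>x\<close>.\<close>

definition downstream ::
  "'a::metric_space set \<Rightarrow> nat \<Rightarrow> (nat \<Rightarrow> 'a \<Rightarrow> 'a) \<Rightarrow> 'a \<Rightarrow> 'a \<Rightarrow> bool" where
  "downstream X m f x y \<longleftrightarrow> (\<forall>\<epsilon>>0. eps_chain X m f \<epsilon> x y)"

definition chain_equivalent ::
  "'a::metric_space set \<Rightarrow> nat \<Rightarrow> (nat \<Rightarrow> 'a \<Rightarrow> 'a) \<Rightarrow> 'a \<Rightarrow> 'a \<Rightarrow> bool" where
  "chain_equivalent X m f x y \<longleftrightarrow> downstream X m f x y \<and> downstream X m f y x"

definition chain_recurrent_set ::
  "'a::metric_space set \<Rightarrow> nat \<Rightarrow> (nat \<Rightarrow> 'a \<Rightarrow> 'a) \<Rightarrow> 'a set" where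
  "chain_recurrent_set X m f = {x \<in> X. \<forall>z\<in>orbit m f x. chain_equivalent X m f x z}"

definition chain_rel ::
  "'a::metric_space set \<Rightarrow> nat \<Rightarrow> (nat \<Rightarrow> 'a \<Rightarrow> 'a) \<Rightarrow> 'a rel" where
  "chain_rel X m f =
     {(x, y) \<in> chain_recurrent_set X m f \<times> chain_recurrent_set X m f. chain_equivalent X m f x y}"

definition chain_nodes ::
  "'a::metric_space set \<Rightarrow> nat \<Rightarrow> (nat \<Rightarrow> 'a \<Rightarrow> 'a) \<Rightarrow> 'a set set" where
  "chain_nodes X m f = chain_recurrent_set X m f // chain_rel X m f"

definition chain_graph ::
  "'a::metric_space set \<Rightarrow> nat \<Rightarrow> (nat \<Rightarrow> 'a \<Rightarrow> 'a) \<Rightarrow> 'a set pair_pre_digraph" where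
  "chain_graph X m f =
     \<lparr>pverts = chain_nodes X m f,
      parcs = {(M, N) \<in> chain_nodes X m f \<times> chain_nodes X m f.
                 M \<noteq> N \<and> (\<exists>x\<in>M. \<exists>y\<in>N. downstream X m f x y)}\<rparr>"

lemma eps_chain_refl: "x \<in> X \<Longrightarrow> eps_chain X m f \<epsilon> x x"
  unfolding eps_chain_def
  by (rule exI[of _ 0], rule exI[of _ "\<lambda>_. x"]) simp

lemma eps_chain_trans:
  assumes "eps_chain X m f \<epsilon> x y" "eps_chain X m f \<epsilon> y z"
  shows "eps_chain X m f \<epsilon> x z"
proof -
  obtain k xs js where 1: "xs 0 = x" "xs k = y" "\<forall>n\<le>k. xs n \<in> X"
      "\<forall>n<k. js n \<in> {1..m} \<and> dist (f (js n) (xs n)) (xs (Suc n)) < \<epsilon>"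
    using assms(1) unfolding eps_chain_def by blast
  obtain l ys hs where 2: "ys 0 = y" "ys l = z" "\<forall>n\<le>l. ys n \<in> X"
      "\<forall>n<l. hs n \<in> {1..m} \<and> dist (f (hs n) (ys n)) (ys (Suc n)) < \<epsilon>"
    using assms(2) unfolding eps_chain_def by blast
  let ?xs = "\<lambda>n. if n < k then xs n else ys (n - k)"
  let ?js = "\<lambda>n. if n < k then js n else hs (n - k)"
  have "?js n \<in> {1..m} \<and> dist (f (?js n) (?xs n)) (?xs (Suc n)) < \<epsilon>" if n: "n < k + l" for n
  proof (cases "n < k")
    case True
    then have "?xs (Suc n) = xs (Suc n)"
      using 1(2) 2(1) by (cases "Suc n = k") auto
    with True 1(4) show ?thesis by auto
  next
    case False
    with n have "n - k < l" by linarith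
    with False 2(4) show ?thesis by (auto simp: Suc_diff_le)
  qed
  moreover have "?xs 0 = x" using 1 2 by (cases "k = 0") auto
  moreover have "?xs (k + l) = z" using 2 by simp
  moreover have "\<forall>n\<le>k + l. ?xs n \<in> X" using 1(3) 2(3) by auto
  ultimately show ?thesis unfolding eps_chain_def
    by (intro exI[of _ "k + l"] exI[of _ ?xs] exI[of _ ?js]) blast
qed

lemma equiv_chain_rel: "equiv (chain_recurrent_set X m f) (chain_rel X m f)"
proof (rule equivI)
  show "chain_rel X m f \<subseteq> chain_recurrent_set X m f \<times> chain_recurrent_set X m f"
    by (auto simp: chain_rel_def)
  show "refl_on (chain_recurrent_set X m f) (chain_rel X m f)"
    by (auto simp: refl_on_def chain_rel_def chain_equivalent_def downstream_def
        chain_recurrent_set_def eps_chain_refl)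
  show "sym (chain_rel X m f)"
    by (auto simp: sym_def chain_rel_def chain_equivalent_def)
  show "trans (chain_rel X m f)"
    unfolding trans_def chain_rel_def chain_equivalent_def downstream_def
    using eps_chain_trans by fast
qed

lemma ifs_restrict_attractor:
  assumes "ifs X m f" "is_global_attractor X m f A"
  shows "ifs A m (ifs_restrict f A)"
proof -
  have A: "A \<subseteq> X" "hutchinson m f A = A" and m: "1 \<le> m"
    and c: "\<And>i. i \<in> {1..m} \<Longrightarrow> continuous_on X (f i)"
    using assms by (auto simp: ifs_def is_global_attractor_def)
  have "continuous_on A (restrict (f i) A) \<and> restrict (f i) A ` A \<subseteq> A" if i: "i \<in> {1..m}" for i
  proof
    have "continuous_on A (f i)" using c[OF i] A(1) continuous_on_subset by blast
    then show "continuous_on A (restrict (f i) A)" by (rule continuous_on_eq) simp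
    have "f i ` A \<subseteq> A" using A(2) i unfolding hutchinson_def by blast
    then show "restrict (f i) A ` A \<subseteq> A" by auto
  qed
  with m show ?thesis by (auto simp: ifs_def ifs_restrict_def)
qed

lemma hutchinson_invariant_words:
  assumes "hutchinson m f A = A" "a \<in> A"
  shows "\<exists>I\<in>words m. length I = n \<and> a \<in> word_map f I ` A"
  using assms(2)
proof (induction n arbitrary: a)
  case 0
  then show ?case by (auto simp: words_def word_map_def intro: bexI[of _ "[]"])
next
  case (Suc n)
  then obtain i b where ib: "i \<in> {1..m}" "b \<in> A" "a = f i b"
    using assms(1) unfolding hutchinson_def by blast
  with Suc.IH obtain I where I: "I \<in> words m" "length I = n" "b \<in> word_map f I ` A" by blast
  have "a \<in> word_map f (i # I) ` A"
    using I(3) ib(3) by (auto simp: word_map_def)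
  moreover have "i # I \<in> words m" "length (i # I) = Suc n"
    using I ib by (auto simp: words_def)
  ultimately show ?case by blast
qed

lemma global_attractor_subset:
  assumes "is_global_attractor X m f A" "is_global_attractor X m f B"
  shows "A \<subseteq> B"
proof
  fix a assume a: "a \<in> A"
  have A: "hutchinson m f A = A" "compact A" "A \<subseteq> X"
    and B: "compact B" "B \<noteq> {}" "attracts X m f B A"
    using assms unfolding is_global_attractor_def by auto
  have "infdist a B < \<epsilon>" if \<epsilon>: "0 < \<epsilon>" for \<epsilon>
  proof -
    obtain \<tau> where \<tau>: "\<forall>I\<in>words m. \<tau> \<le> length I \<longrightarrow> word_map f I ` A \<subseteq> nbhd X \<epsilon> B"
      using B(3) \<epsilon> unfolding attracts_def by blast
    obtain I where "I \<in> words m" "length I = \<tau>" "a \<in> word_map f I ` A"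
      using hutchinson_invariant_words[OF A(1) a] by blast
    with \<tau> show ?thesis unfolding nbhd_def by blast
  qed
  then have "infdist a B = 0"
    using infdist_nonneg[of a B] by (metis less_irrefl order_le_less)
  with B show "a \<in> B"
    using in_closed_iff_infdist_zero[of B a] compact_imp_closed by blast
qed

lemma global_attractor_eq:
  assumes "is_global_attractor X m f A"
  shows "global_attractor X m f = A"
  unfolding global_attractor_def
  using assms global_attractor_subset by (intro the_equality) blast+

end

theory Submission
  imports Defs
begin

text \<open>
  Write \<open>G\<close> for the global attractor. Everything follows from one fact
  (\<open>pseudo_orbits_stay_near_attractor\<close>): for every \<open>\<eta>\<close> there are \<open>\<delta>\<close> and \<open>\<epsilon>\<close> such that an
  \<open>\<epsilon>\<close>-chain which starts \<open>\<delta>\<close>-close to \<open>G\<close> remains \<open>\<eta>\<close>-close to \<open>G\<close> for ever, however long it is.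

  It holds because \<open>\<epsilon>\<close>-chains of a fixed length starting in a compact set are shadowed by true
  orbits (\<open>shadowing\<close>). By local compactness, a neighbourhood of \<open>G\<close> lies in a compact set \<open>K\<close>;
  shrink \<open>\<eta>\<close> until \<open>K\<close> contains the \<open>\<eta>\<close>-neighbourhood of \<open>G\<close>. There is a time \<open>\<tau>\<close> after which
  every word moves \<open>K\<close> to within \<open>\<eta>/2\<close> of \<open>G\<close>. During its first \<open>\<tau>\<close> steps the chain shadows an orbit in the invariant set \<open>G\<close>. At any later time \<open>n\<close> it shadows
  the true orbit of its own point at time \<open>n - \<tau>\<close>, which by induction is still in \<open>K\<close>; so the error
  never accumulates over more than \<open>\<tau>\<close> steps.

  There are two consequences. A chain-recurrent point \<open>x\<close> is downstream from the points of its
  orbit, which come arbitrarily close to \<open>G\<close>; hence \<open>x\<close> is arbitrarily close to \<open>G\<close>, that is,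
  \<open>x \<in> G\<close>. And a fine chain in \<open>X\<close> between two points of \<open>G\<close> runs so close to \<open>G\<close> that replacing
  each of its points by a nearby point of \<open>G\<close> gives a chain in \<open>G\<close>; hence the downstream relations
  of \<open>\<F>\<close> and of its restriction agree on \<open>G\<close> (\<open>downstream_attractor_iff\<close>). The chain-recurrent
  set, the nodes and the graph depend only on that relation and on the orbits, and orbits in \<open>G\<close> are
  the same for both systems.
\<close>

section \<open>Uniform estimates near compact sets\<close>

lemma nbhd_iff: "x \<in> nbhd X \<epsilon> A \<longleftrightarrow> x \<in> X \<and> (\<exists>a\<in>A. dist a x < \<epsilon>)"
proof (cases "A = {}")
  case False
  have "infdist x A < \<epsilon> \<longleftrightarrow> (\<exists>a\<in>A. dist x a < \<epsilon>)"
    unfolding infdist_notempty[OF False]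
    using False by (subst cINF_less_iff) auto
  with False show ?thesis by (auto simp: nbhd_def dist_commute)
qed (simp add: nbhd_def)

lemma finite_common_bound:
  fixes P :: "'i \<Rightarrow> real \<Rightarrow> bool"
  assumes "finite I" and "\<And>i. i \<in> I \<Longrightarrow> \<exists>\<epsilon>>0. P i \<epsilon>"
    and mono: "\<And>i \<epsilon> \<epsilon>'. P i \<epsilon> \<Longrightarrow> \<epsilon>' \<le> \<epsilon> \<Longrightarrow> P i \<epsilon>'"
  shows "\<exists>\<epsilon>>0. \<forall>i\<in>I. P i \<epsilon>"
  using assms(1,2)
proof (induction I)
  case empty
  then show ?case by (auto intro: exI[of _ 1])
next
  case (insert i I)
  then obtain \<epsilon> where "\<epsilon> > 0" "\<forall>i\<in>I. P i \<epsilon>" by auto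
  moreover obtain \<epsilon>' where "\<epsilon>' > 0" "P i \<epsilon>'" using insert.prems by auto
  ultimately have "min \<epsilon> \<epsilon>' > 0 \<and> (\<forall>i\<in>insert i I. P i (min \<epsilon> \<epsilon>'))"
    using mono by (metis insert_iff min.cobounded1 min.cobounded2 min_less_iff_conj)
  then show ?case by blast
qed

text \<open>
  A one-sided Heine--Cantor theorem: only one of the two points is confined to the compact set, as
  when a point of a chain is compared with an orbit in that set. The modulus \<open>\<delta>\<close> is a Lebesgue number of the
  cover by open sets on which \<open>h\<close> oscillates by less than \<open>\<gamma>\<close>.
\<close>

lemma uniformly_continuous_at_compact:
  fixes h :: "'a::metric_space \<Rightarrow> 'b::metric_space"
  assumes "continuous_on X h" "compact C" "C \<subseteq> X" "\<gamma> > 0"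
  shows "\<exists>\<delta>>0. \<forall>c\<in>C. \<forall>x\<in>X. dist c x < \<delta> \<longrightarrow> dist (h c) (h x) < \<gamma>"
proof -
  let ?W = "{W. open W \<and> (\<forall>x\<in>X \<inter> W. \<forall>y\<in>X \<inter> W. dist (h x) (h y) < \<gamma>)}"
  have "C \<subseteq> \<Union>?W"
  proof
    fix c assume "c \<in> C"
    then have "c \<in> X" using assms(3) by auto
    then obtain \<delta> where \<delta>: "\<delta> > 0" "\<forall>x\<in>X. dist x c < \<delta> \<longrightarrow> dist (h x) (h c) < \<gamma>/2"
      using assms(1,4) unfolding continuous_on_iff by (meson half_gt_zero)
    have "dist (h x) (h y) < \<gamma>" if "x \<in> X" "dist c x < \<delta>" "y \<in> X" "dist c y < \<delta>" for x y
    proof (rule dist_triangle_half_r)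
      show "dist (h c) (h x) < \<gamma>/2" "dist (h c) (h y) < \<gamma>/2"
        using \<delta>(2) that by (metis dist_commute)+
    qed
    then have "ball c \<delta> \<in> ?W" by auto
    with \<delta>(1) show "c \<in> \<Union>?W" by (meson UnionI centre_in_ball)
  qed
  then obtain \<delta> where \<delta>: "\<delta> > 0" "\<And>c. c \<in> C \<Longrightarrow> \<exists>W\<in>?W. ball c \<delta> \<subseteq> W"
    using Heine_Borel_lemma[OF assms(2), of ?W] by (metis (no_types, lifting) mem_Collect_eq)
  have "dist (h c) (h x) < \<gamma>" if c: "c \<in> C" and x: "x \<in> X" "dist c x < \<delta>" for c x
  proof -
    obtain W where W: "W \<in> ?W" "ball c \<delta> \<subseteq> W" using \<delta>(2)[OF c] by blast
    have "c \<in> X \<inter> W" "x \<in> X \<inter> W" using W(2) c x assms(3) \<delta>(1) by auto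
    with W(1) show ?thesis by blast
  qed
  with \<delta>(1) show ?thesis by blast
qed

lemma ifs_uniformly_continuous_at_compact:
  assumes "ifs X m f" "compact C" "C \<subseteq> X" "\<gamma> > 0"
  shows "\<exists>\<delta>>0. \<forall>i\<in>{1..m}. \<forall>c\<in>C. \<forall>x\<in>X. dist c x < \<delta> \<longrightarrow> dist (f i c) (f i x) < \<gamma>"
proof (rule finite_common_bound)
  fix i assume "i \<in> {1..m}"
  then have "continuous_on X (f i)" using assms(1) by (auto simp: ifs_def)
  then show "\<exists>\<delta>>0. \<forall>c\<in>C. \<forall>x\<in>X. dist c x < \<delta> \<longrightarrow> dist (f i c) (f i x) < \<gamma>"
    using uniformly_continuous_at_compact assms by blast
qed fastforce+

lemma compact_neighbourhood:
  assumes "locally compact X" "compact G" "G \<subseteq> X"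
  shows "\<exists>r>0. \<exists>K. compact K \<and> K \<subseteq> X \<and> nbhd X r G \<subseteq> K"
proof -
  define P where "P W \<longleftrightarrow> open W \<and> (\<exists>K. compact K \<and> K \<subseteq> X \<and> X \<inter> W \<subseteq> K)" for W
  have cover: "\<exists>W. P W \<and> x \<in> W" if x: "x \<in> G" for x
  proof -
    have "openin (top_of_set X) X" "x \<in> X" using x assms(3) by auto
    then obtain u v where uv: "openin (top_of_set X) u" "compact v" "x \<in> u" "u \<subseteq> v" "v \<subseteq> X"
      using assms(1) unfolding locally_def by meson
    then obtain W where "open W" "u = X \<inter> W" by (auto simp: openin_open)
    with uv show ?thesis unfolding P_def by blast
  qed
  obtain D where D: "D \<subseteq> Collect P" "finite D" "G \<subseteq> \<Union>D"
  proof (rule compactE[OF assms(2)])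
    show "G \<subseteq> \<Union>(Collect P)" using cover by auto
    show "open W" if "W \<in> Collect P" for W using that by (simp add: P_def)
  qed
  have "P (\<Union>D)"
    using D(2,1)
  proof (induction D)
    case empty
    then show ?case by (auto simp: P_def intro: exI[of _ "{}"])
  next
    case (insert W D)
    then have "P W" "P (\<Union>D)" by auto
    then obtain K L where "compact K" "K \<subseteq> X" "X \<inter> W \<subseteq> K" "compact L" "L \<subseteq> X" "X \<inter> \<Union>D \<subseteq> L"
      unfolding P_def by auto
    then have "compact (K \<union> L) \<and> K \<union> L \<subseteq> X \<and> X \<inter> \<Union>(insert W D) \<subseteq> K \<union> L"
      by (auto simp: compact_Un)
    moreover have "open (\<Union>(insert W D))" using \<open>P W\<close> \<open>P (\<Union>D)\<close> by (auto simp: P_def)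
    ultimately show ?case unfolding P_def by blast
  qed
  then obtain K where K: "open (\<Union>D)" "compact K" "K \<subseteq> X" "X \<inter> \<Union>D \<subseteq> K"
    unfolding P_def by (elim conjE exE) (rule that)
  obtain r where r: "r > 0" "\<And>x. x \<in> G \<Longrightarrow> ball x r \<subseteq> \<Union>D"
  proof (rule Heine_Borel_lemma[OF assms(2), of "{\<Union>D}"])
    show "G \<subseteq> \<Union>{\<Union>D}" using D(3) by simp
    show "open W" if "W \<in> {\<Union>D}" for W using that K(1) by blast
  qed blast
  have "nbhd X r G \<subseteq> K"
  proof
    fix x assume "x \<in> nbhd X r G"
    then obtain a where "x \<in> X" "a \<in> G" "x \<in> ball a r" by (auto simp: nbhd_iff)
    with r(2) K(4) show "x \<in> K" by blast
  qed
  with r(1) K show ?thesis by blast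
qed

section \<open>Pseudo-orbits and shadowing\<close>

text \<open>
  The sequence underlying an \<open>\<epsilon>\<close>-chain. It is named so that single points along a chain, and
  pieces of it, can be discussed.
\<close>

definition pseudo_orbit ::
  "'a::metric_space set \<Rightarrow> nat \<Rightarrow> (nat \<Rightarrow> 'a \<Rightarrow> 'a) \<Rightarrow> real \<Rightarrow> nat \<Rightarrow> (nat \<Rightarrow> 'a) \<Rightarrow> (nat \<Rightarrow> nat) \<Rightarrow> bool"
  where
  "pseudo_orbit X m f \<epsilon> k xs js \<longleftrightarrow> (\<forall>n\<le>k. xs n \<in> X) \<and>
     (\<forall>n<k. js n \<in> {1..m} \<and> dist (f (js n) (xs n)) (xs (Suc n)) < \<epsilon>)"

lemma eps_chain_iff_pseudo_orbit:
  "eps_chain X m f \<epsilon> x y \<longleftrightarrow> (\<exists>k xs js. xs 0 = x \<and> xs k = y \<and> pseudo_orbit X m f \<epsilon> k xs js)"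
  unfolding eps_chain_def pseudo_orbit_def by blast

lemma pseudo_orbit_mono:
  "pseudo_orbit X m f \<epsilon>' k xs js \<Longrightarrow> \<epsilon>' \<le> \<epsilon> \<Longrightarrow> pseudo_orbit X m f \<epsilon> k xs js"
  unfolding pseudo_orbit_def by fastforce

lemma pseudo_orbit_segment:
  assumes "pseudo_orbit X m f \<epsilon> k xs js" "l + n \<le> k"
  shows "pseudo_orbit X m f \<epsilon> n (\<lambda>i. xs (l + i)) (\<lambda>i. js (l + i))"
  using assms unfolding pseudo_orbit_def by auto

lemma compact_hutchinson:
  assumes "ifs X m f" "compact K" "K \<subseteq> X"
  shows "compact (hutchinson m f K)" "hutchinson m f K \<subseteq> X"
proof -
  have "compact (f i ` K)" if "i \<in> {1..m}" for i
    using assms that by (auto simp: ifs_def intro!: compact_continuous_image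
      intro: continuous_on_subset)
  then show "compact (hutchinson m f K)" unfolding hutchinson_def by (intro compact_UN) auto
  show "hutchinson m f K \<subseteq> X" using assms unfolding hutchinson_def ifs_def by blast
qed

text \<open>
  The induction splits off the first step, which carries the compact set \<open>K\<close> to the compact set
  \<open>hutchinson m f K\<close>; therefore \<open>K\<close> is generalised. The shadowing orbit starts at a point \<open>p\<close> of
  \<open>K\<close> that is only close to the start of the chain: this absorbs the error of the step split off,
  and it also covers chains that start merely near an invariant set.
\<close>

lemma shadowing:
  assumes "ifs X m f" "compact K" "K \<subseteq> X" "\<gamma> > 0"
  shows "\<exists>\<epsilon>>0. \<forall>p\<in>K. \<forall>xs js. dist p (xs 0) < \<epsilon> \<longrightarrow> pseudo_orbit X m f \<epsilon> n xs js \<longrightarrow>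
           (\<exists>J\<in>words m. length J = n \<and> dist (word_map f J p) (xs n) < \<gamma>)"
  using assms(2,3)
proof (induction n arbitrary: K)
  case 0
  show ?case
    using assms(4) by (auto intro!: exI[of _ \<gamma>] bexI[of _ "[]"] simp: words_def word_map_def)
next
  case (Suc n)
  obtain \<epsilon> where \<epsilon>: "\<epsilon> > 0" and
    IH: "\<And>q ys hs. \<lbrakk>q \<in> hutchinson m f K; dist q (ys 0) < \<epsilon>; pseudo_orbit X m f \<epsilon> n ys hs\<rbrakk> \<Longrightarrow>
           \<exists>J\<in>words m. length J = n \<and> dist (word_map f J q) (ys n) < \<gamma>"
    using Suc.IH[OF compact_hutchinson[OF assms(1) Suc.prems]] by blast
  obtain \<delta> where \<delta>: "\<delta> > 0"
    "\<forall>i\<in>{1..m}. \<forall>c\<in>K. \<forall>x\<in>X. dist c x < \<delta> \<longrightarrow> dist (f i c) (f i x) < \<epsilon>/2"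
    using ifs_uniformly_continuous_at_compact[OF assms(1) Suc.prems, of "\<epsilon>/2"] \<epsilon> by auto
  let ?e = "min \<delta> (\<epsilon>/2)"
  have "\<exists>J\<in>words m. length J = Suc n \<and> dist (word_map f J p) (xs (Suc n)) < \<gamma>"
    if p: "p \<in> K" "dist p (xs 0) < ?e" and po: "pseudo_orbit X m f ?e (Suc n) xs js" for p xs js
  proof -
    have j: "js 0 \<in> {1..m}" "xs 0 \<in> X" "dist (f (js 0) (xs 0)) (xs 1) < \<epsilon>/2"
      using po unfolding pseudo_orbit_def by auto
    have "dist (f (js 0) p) (f (js 0) (xs 0)) < \<epsilon>/2" using \<delta>(2) j p by auto
    then have "dist (f (js 0) p) (xs 1) < \<epsilon>"
      using j(3) dist_triangle[of "f (js 0) p" "xs 1" "f (js 0) (xs 0)"] by linarith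
    moreover have "f (js 0) p \<in> hutchinson m f K" using j(1) p(1) unfolding hutchinson_def by blast
    moreover have "pseudo_orbit X m f \<epsilon> n (\<lambda>i. xs (1 + i)) (\<lambda>i. js (1 + i))"
      using pseudo_orbit_segment[OF po, of 1 n] pseudo_orbit_mono[of X m f ?e n _ _ \<epsilon>] \<epsilon> by auto
    ultimately obtain J where J: "J \<in> words m" "length J = n"
      "dist (word_map f J (f (js 0) p)) (xs (Suc n)) < \<gamma>"
      using IH[of "f (js 0) p" "\<lambda>i. xs (1 + i)" "\<lambda>i. js (1 + i)"] by auto
    have "J @ [js 0] \<in> words m" using J(1) j(1) by (auto simp: words_def)
    moreover have "word_map f (J @ [js 0]) p = word_map f J (f (js 0) p)"
      by (simp add: word_map_def)
    ultimately show ?thesis using J by (intro bexI[of _ "J @ [js 0]"]) auto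
  qed
  then show ?case using \<epsilon> \<delta>(1) by (intro exI[of _ ?e]) auto
qed

section \<open>Chains near the global attractor\<close>

lemma word_map_invariant:
  assumes "hutchinson m f G = G" "I \<in> words m" "x \<in> G"
  shows "word_map f I x \<in> G"
  using assms(2)
proof (induction I)
  case (Cons i I)
  then have "word_map f I x \<in> G" "i \<in> {1..m}" by (auto simp: words_def)
  then have "f i (word_map f I x) \<in> hutchinson m f G" unfolding hutchinson_def by blast
  with assms(1) show ?case by (simp add: word_map_def)
qed (use assms(3) in \<open>simp add: word_map_def\<close>)

text \<open>
  The tolerances do not depend on the length of the chain, since the attraction time \<open>\<tau>\<close> bounds how
  long an orbit has to be shadowed.
\<close>

lemma pseudo_orbits_stay_near_attractor:
  assumes "locally compact X" "ifs X m f" "is_global_attractor X m f G" "\<eta> > 0"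
  shows "\<exists>\<delta>>0. \<exists>\<epsilon>>0. \<forall>k xs js. xs 0 \<in> nbhd X \<delta> G \<longrightarrow> pseudo_orbit X m f \<epsilon> k xs js \<longrightarrow>
           (\<forall>n\<le>k. xs n \<in> nbhd X \<eta> G)"
proof -
  have G: "G \<subseteq> X" "compact G" "hutchinson m f G = G"
    "\<And>K. K \<subseteq> X \<Longrightarrow> compact K \<Longrightarrow> attracts X m f G K"
    using assms(3) by (auto simp: is_global_attractor_def)
  obtain r K where K: "r > 0" "compact K" "K \<subseteq> X" "nbhd X r G \<subseteq> K"
    using compact_neighbourhood[OF assms(1) G(2,1)] by blast
  \<comment> \<open>Staying \<open>\<rho>\<close>-close to \<open>G\<close> also keeps the chain in \<open>K\<close>, where the attraction time is uniform.\<close>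
  define \<rho> where "\<rho> = min r \<eta>"
  have \<rho>: "\<rho> > 0" using K(1) assms(4) by (simp add: \<rho>_def)
  obtain \<tau> where \<tau>: "\<tau> > 0"
    "\<And>I. I \<in> words m \<Longrightarrow> \<tau> \<le> length I \<Longrightarrow> word_map f I ` K \<subseteq> nbhd X (\<rho>/2) G"
    using G(4)[OF K(3,2)] \<rho> unfolding attracts_def by (meson half_gt_zero)
  obtain \<epsilon>1 where \<epsilon>1: "\<epsilon>1 > 0"
    and late: "\<And>p xs js. \<lbrakk>p \<in> K; dist p (xs 0) < \<epsilon>1; pseudo_orbit X m f \<epsilon>1 \<tau> xs js\<rbrakk> \<Longrightarrow>
      \<exists>J\<in>words m. length J = \<tau> \<and> dist (word_map f J p) (xs \<tau>) < \<rho>/2"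
    using shadowing[OF assms(2) K(2,3) half_gt_zero[OF \<rho>], of \<tau>] by blast
  let ?Q = "\<lambda>n \<epsilon>. \<forall>p\<in>G. \<forall>xs js. dist p (xs 0) < \<epsilon> \<longrightarrow> pseudo_orbit X m f \<epsilon> n xs js \<longrightarrow>
     (\<exists>J\<in>words m. length J = n \<and> dist (word_map f J p) (xs n) < \<rho>)"
  have "\<exists>\<epsilon>>0. \<forall>n\<in>{..<\<tau>}. ?Q n \<epsilon>"
  proof (rule finite_common_bound)
    show "\<exists>\<epsilon>>0. ?Q n \<epsilon>" for n by (rule shadowing[OF assms(2) G(2,1) \<rho>])
    show "?Q n \<epsilon>'" if "?Q n \<epsilon>" "\<epsilon>' \<le> \<epsilon>" for n \<epsilon> \<epsilon>'
      using that pseudo_orbit_mono by (meson less_le_trans)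
  qed simp
  then obtain \<epsilon>2 where \<epsilon>2: "\<epsilon>2 > 0" and early: "\<And>n. n < \<tau> \<Longrightarrow> ?Q n \<epsilon>2" by auto
  define \<epsilon> where "\<epsilon> = min \<epsilon>1 \<epsilon>2"
  have \<epsilon>: "\<epsilon> > 0" "\<epsilon> \<le> \<epsilon>1" "\<epsilon> \<le> \<epsilon>2" using \<epsilon>1 \<epsilon>2 by (auto simp: \<epsilon>_def)
  have "xs n \<in> nbhd X \<rho> G"
    if start: "xs 0 \<in> nbhd X \<epsilon>2 G" and po: "pseudo_orbit X m f \<epsilon> k xs js" and "n \<le> k" for k xs js n
    using \<open>n \<le> k\<close>
  proof (induction n rule: less_induct)
    case (less n)
    have X: "xs n \<in> X" using po less.prems by (auto simp: pseudo_orbit_def)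
    show ?case
    proof (cases "n < \<tau>")
      case True
      obtain p where p: "p \<in> G" "dist p (xs 0) < \<epsilon>2" using start by (auto simp: nbhd_iff)
      have "pseudo_orbit X m f \<epsilon>2 n xs js"
        using pseudo_orbit_segment[OF po, of 0 n] less.prems \<epsilon>(3) pseudo_orbit_mono by fastforce
      then obtain J where "J \<in> words m" "dist (word_map f J p) (xs n) < \<rho>"
        using early[OF True] p by blast
      with word_map_invariant[OF G(3) _ p(1)] X show ?thesis by (auto simp: nbhd_iff)
    next
      case False
      define l where "l = n - \<tau>"
      have l: "n = l + \<tau>" "l < n" using False \<tau>(1) by (auto simp: l_def)
      have "xs l \<in> nbhd X \<rho> G" using less l by auto
      moreover have "nbhd X \<rho> G \<subseteq> nbhd X r G" by (auto simp: nbhd_iff \<rho>_def)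
      ultimately have "xs l \<in> K" using K(4) by blast
      moreover have "pseudo_orbit X m f \<epsilon>1 \<tau> (\<lambda>i. xs (l + i)) (\<lambda>i. js (l + i))"
        using pseudo_orbit_segment[OF po, of l \<tau>] l less.prems \<epsilon>(2) pseudo_orbit_mono by blast
      ultimately obtain J where J: "J \<in> words m" "length J = \<tau>"
        "dist (word_map f J (xs l)) (xs n) < \<rho>/2"
        using late[of "xs l" "\<lambda>i. xs (l + i)" "\<lambda>i. js (l + i)"] \<epsilon>1 l(1) by auto
      have "word_map f J (xs l) \<in> nbhd X (\<rho>/2) G" using \<tau>(2)[of J] J \<open>xs l \<in> K\<close> by auto
      then obtain a where a: "a \<in> G" "dist a (word_map f J (xs l)) < \<rho>/2" by (auto simp: nbhd_iff)
      then have "dist a (xs n) < \<rho>"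
        using J(3) dist_triangle[of a "xs n" "word_map f J (xs l)"] by linarith
      with a(1) X show ?thesis by (auto simp: nbhd_iff)
    qed
  qed
  moreover have "nbhd X \<rho> G \<subseteq> nbhd X \<eta> G" by (auto simp: nbhd_iff \<rho>_def)
  ultimately show ?thesis using \<epsilon>(1) \<epsilon>2 by (meson subsetD)
qed

text \<open>
  A point of the orbit of \<open>x\<close> at a late time is close to \<open>G\<close>, and chain recurrence gives arbitrarily
  fine chains from there back to \<open>x\<close>, which remain close to \<open>G\<close>.
\<close>

lemma chain_recurrent_set_subset_attractor:
  assumes "locally compact X" "ifs X m f" "is_global_attractor X m f G"
  shows "chain_recurrent_set X m f \<subseteq> G"
proof
  fix x assume x: "x \<in> chain_recurrent_set X m f"
  then have xX: "x \<in> X" by (simp add: chain_recurrent_set_def)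
  have G: "closed G" "G \<noteq> {}" "attracts X m f G {x}"
    using assms(3) xX by (auto simp: is_global_attractor_def compact_imp_closed)
  have "infdist x G < \<eta>" if "\<eta> > 0" for \<eta>
  proof -
    obtain \<delta> \<epsilon> where \<delta>: "\<delta> > 0" and \<epsilon>: "\<epsilon> > 0"
      and stay: "\<And>k xs js n. \<lbrakk>xs 0 \<in> nbhd X \<delta> G; pseudo_orbit X m f \<epsilon> k xs js; n \<le> k\<rbrakk> \<Longrightarrow>
                   xs n \<in> nbhd X \<eta> G"
      using pseudo_orbits_stay_near_attractor[OF assms \<open>\<eta> > 0\<close>] by blast
    obtain \<tau> where \<tau>: "\<forall>I\<in>words m. \<tau> \<le> length I \<longrightarrow> word_map f I ` {x} \<subseteq> nbhd X \<delta> G"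
      using G(3) \<delta> unfolding attracts_def by blast
    \<comment> \<open>Any word of length \<open>\<tau>\<close> will do; the letter \<open>1\<close> exists because \<open>m \<ge> 1\<close>.\<close>
    define I where "I = replicate \<tau> (1::nat)"
    have I: "I \<in> words m" "length I = \<tau>"
      using assms(2) by (auto simp: I_def words_def ifs_def)
    have "word_map f I x \<in> orbit m f x" using I(1) unfolding orbit_def by blast
    then have "eps_chain X m f \<epsilon> (word_map f I x) x"
      using x \<epsilon> by (auto simp: chain_recurrent_set_def chain_equivalent_def downstream_def)
    then obtain k xs js where "xs 0 = word_map f I x" "xs k = x" "pseudo_orbit X m f \<epsilon> k xs js"
      unfolding eps_chain_iff_pseudo_orbit by blast
    moreover have "word_map f I x \<in> nbhd X \<delta> G" using \<tau> I by auto
    ultimately have "x \<in> nbhd X \<eta> G" using stay[of xs k js k] by auto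
    then show ?thesis by (simp add: nbhd_def)
  qed
  then have "infdist x G = 0"
    using infdist_nonneg[of x G] by (metis less_irrefl order_le_less)
  with G show "x \<in> G" using in_closed_iff_infdist_zero by blast
qed

lemma eps_chain_restrict:
  "eps_chain G m (ifs_restrict f G) \<epsilon> x y \<longleftrightarrow> eps_chain G m f \<epsilon> x y"
proof -
  have "pseudo_orbit G m (ifs_restrict f G) \<epsilon> k xs js \<longleftrightarrow> pseudo_orbit G m f \<epsilon> k xs js" for k xs js
    unfolding pseudo_orbit_def ifs_restrict_def by (metis less_imp_le restrict_apply')
  then show ?thesis unfolding eps_chain_iff_pseudo_orbit by (simp only:)
qed

text \<open>
  The projected chain \<open>ps\<close> below keeps the end points, since a point of \<open>G\<close> is projected to itself.
  Its jumps are bounded by the variation of the maps between \<open>xs n\<close> and \<open>ps n\<close>, the jump of \<open>xs\<close>,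
  and the displacement of \<open>xs (n + 1)\<close>; each contributes a third of \<open>\<epsilon>\<close>.
\<close>

lemma downstream_attractor_iff:
  assumes "locally compact X" "ifs X m f" "is_global_attractor X m f G" "x \<in> G" "y \<in> G"
  shows "downstream X m f x y \<longleftrightarrow> downstream G m (ifs_restrict f G) x y"
proof -
  have G: "G \<subseteq> X" "compact G" using assms(3) by (auto simp: is_global_attractor_def)
  show ?thesis
  proof
    assume "downstream G m (ifs_restrict f G) x y"
    moreover have "pseudo_orbit G m f \<epsilon> k xs js \<Longrightarrow> pseudo_orbit X m f \<epsilon> k xs js" for \<epsilon> k xs js
      using G(1) unfolding pseudo_orbit_def by (meson subsetD)
    then have "eps_chain G m f \<epsilon> x y \<Longrightarrow> eps_chain X m f \<epsilon> x y" for \<epsilon>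
      unfolding eps_chain_iff_pseudo_orbit by metis
    ultimately show "downstream X m f x y"
      unfolding downstream_def eps_chain_restrict by simp
  next
    assume ds: "downstream X m f x y"
    have "eps_chain G m f \<epsilon> x y" if \<epsilon>: "\<epsilon> > 0" for \<epsilon>
    proof -
      obtain \<gamma> where \<gamma>: "\<gamma> > 0"
        "\<forall>i\<in>{1..m}. \<forall>c\<in>G. \<forall>x\<in>X. dist c x < \<gamma> \<longrightarrow> dist (f i c) (f i x) < \<epsilon>/3"
        using ifs_uniformly_continuous_at_compact[OF assms(2) G(2,1), of "\<epsilon>/3"] \<epsilon> by auto
      define \<eta> where "\<eta> = min \<gamma> (\<epsilon>/3)"
      have \<eta>: "\<eta> > 0" using \<gamma>(1) \<epsilon> by (simp add: \<eta>_def)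
      obtain \<delta> \<epsilon>' where \<delta>: "\<delta> > 0" "\<epsilon>' > 0"
        and stay: "\<And>k xs js n. \<lbrakk>xs 0 \<in> nbhd X \<delta> G; pseudo_orbit X m f \<epsilon>' k xs js; n \<le> k\<rbrakk> \<Longrightarrow>
                     xs n \<in> nbhd X \<eta> G"
        using pseudo_orbits_stay_near_attractor[OF assms(1-3) \<eta>] by blast
      have "eps_chain X m f (min \<epsilon>' (\<epsilon>/3)) x y" using ds \<delta> \<epsilon> by (auto simp: downstream_def)
      then obtain k xs js where xs: "xs 0 = x" "xs k = y"
        and po: "pseudo_orbit X m f (min \<epsilon>' (\<epsilon>/3)) k xs js"
        unfolding eps_chain_iff_pseudo_orbit by blast
      have "xs 0 \<in> nbhd X \<delta> G"
        using xs(1) assms(4) G(1) \<delta>(1) by (auto simp: nbhd_iff intro!: bexI[of _ x])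
      then have near: "\<exists>p\<in>G. dist p (xs n) < \<eta>" if "n \<le> k" for n
        using stay[OF _ pseudo_orbit_mono[OF po] that] by (auto simp: nbhd_iff)
      define ps where "ps n = (if xs n \<in> G then xs n else SOME p. p \<in> G \<and> dist p (xs n) < \<eta>)" for n
      have ps: "ps n \<in> G" "dist (ps n) (xs n) < \<eta>" if "n \<le> k" for n
        using someI_ex[OF near[OF that, unfolded Bex_def]] \<eta> by (auto simp: ps_def)
      have jump: "js n \<in> {1..m} \<and> dist (f (js n) (ps n)) (ps (Suc n)) < \<epsilon>" if "n < k" for n
      proof
        show j: "js n \<in> {1..m}" using po that by (auto simp: pseudo_orbit_def)
        have "dist (f (js n) (ps n)) (f (js n) (xs n)) < \<epsilon>/3"
          using \<gamma>(2) j ps[of n] po that by (auto simp: \<eta>_def pseudo_orbit_def)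
        moreover have "dist (f (js n) (xs n)) (xs (Suc n)) < \<epsilon>/3"
          using po that by (auto simp: pseudo_orbit_def)
        moreover have "dist (ps (Suc n)) (xs (Suc n)) < \<epsilon>/3"
          using ps(2)[of "Suc n"] that by (auto simp: \<eta>_def)
        ultimately show "dist (f (js n) (ps n)) (ps (Suc n)) < \<epsilon>"
          using dist_triangle[of "f (js n) (ps n)" "ps (Suc n)" "f (js n) (xs n)"]
            dist_triangle2[of "f (js n) (xs n)" "ps (Suc n)" "xs (Suc n)"] by linarith
      qed
      have "pseudo_orbit G m f \<epsilon> k ps js"
        using ps(1) jump by (auto simp: pseudo_orbit_def)
      moreover have "ps 0 = x" "ps k = y" using xs assms(4,5) by (auto simp: ps_def)
      ultimately show ?thesis unfolding eps_chain_iff_pseudo_orbit by blast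
    qed
    then show "downstream G m (ifs_restrict f G) x y"
      by (auto simp: downstream_def eps_chain_restrict)
  qed
qed

section \<open>Comparison with the restricted system\<close>

lemma orbit_restrict:
  assumes "hutchinson m f G = G" "x \<in> G"
  shows "orbit m (ifs_restrict f G) x = orbit m f x"
proof -
  have "word_map (ifs_restrict f G) I x = word_map f I x" if "I \<in> words m" for I
    using that
  proof (induction I)
    case (Cons i I)
    then have "I \<in> words m" by (simp add: words_def)
    with Cons.IH word_map_invariant[OF assms(1) _ assms(2)] show ?case
      by (simp add: word_map_def ifs_restrict_def)
  qed (simp add: word_map_def)
  then show ?thesis unfolding orbit_def by (metis (no_types, lifting))
qed

theorem theorem2:
  fixes X :: "'a::metric_space set" and m :: nat and f :: "nat \<Rightarrow> 'a \<Rightarrow> 'a"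
  assumes "locally compact X"
    and "ifs X m f"
    and "compact_dynamics X m f"
  shows "let G = global_attractor X m f; g = ifs_restrict f G in
           chain_recurrent_set X m f = chain_recurrent_set G m g \<and>
           chain_nodes X m f = chain_nodes G m g \<and>
           chain_graph X m f = chain_graph G m g"
proof -
  define G where "G = global_attractor X m f"
  define g where "g = ifs_restrict f G"
  have att: "is_global_attractor X m f G"
    using assms(3) global_attractor_eq unfolding compact_dynamics_def G_def by metis
  then have GX: "G \<subseteq> X" and inv: "hutchinson m f G = G" by (auto simp: is_global_attractor_def)
  have ds: "downstream X m f x y \<longleftrightarrow> downstream G m g x y" if "x \<in> G" "y \<in> G" for x y
    unfolding g_def by (rule downstream_attractor_iff[OF assms(1,2) att that])
  then have ce: "chain_equivalent X m f x y \<longleftrightarrow> chain_equivalent G m g x y"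
    if "x \<in> G" "y \<in> G" for x y
    using that by (simp add: chain_equivalent_def)
  have orb: "orbit m f x \<subseteq> G" if "x \<in> G" for x
    using word_map_invariant[OF inv _ that] by (auto simp: orbit_def)
  have RG: "chain_recurrent_set X m f \<subseteq> G"
    by (rule chain_recurrent_set_subset_attractor[OF assms(1,2) att])
  have R: "chain_recurrent_set X m f = chain_recurrent_set G m g"
  proof -
    have "x \<in> chain_recurrent_set X m f \<longleftrightarrow> x \<in> chain_recurrent_set G m g" if x: "x \<in> G" for x
    proof -
      have "orbit m g x = orbit m f x" unfolding g_def by (rule orbit_restrict[OF inv x])
      moreover have "chain_equivalent X m f x z \<longleftrightarrow> chain_equivalent G m g x z"
        if "z \<in> orbit m f x" for z
        using ce[OF x] orb[OF x] that by blast
      moreover have "x \<in> X" using x GX by blast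
      ultimately show ?thesis using x by (simp add: chain_recurrent_set_def)
    qed
    moreover have "chain_recurrent_set G m g \<subseteq> G" by (auto simp: chain_recurrent_set_def)
    ultimately show ?thesis using RG by blast
  qed
  have "chain_rel X m f = chain_rel G m g"
    unfolding chain_rel_def R[symmetric] using RG ce by blast
  then have N: "chain_nodes X m f = chain_nodes G m g"
    by (simp add: chain_nodes_def R)
  have "M \<subseteq> G" if "M \<in> chain_nodes X m f" for M
    using that RG unfolding chain_nodes_def quotient_def chain_rel_def by auto
  then have "(\<exists>x\<in>M. \<exists>y\<in>M'. downstream X m f x y) \<longleftrightarrow> (\<exists>x\<in>M. \<exists>y\<in>M'. downstream G m g x y)"
    if "M \<in> chain_nodes X m f" "M' \<in> chain_nodes X m f" for M M'
    using that ds by (meson subsetD)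
  then have "chain_graph X m f = chain_graph G m g"
    unfolding chain_graph_def N[symmetric]
    by (simp add: case_prod_beta mem_Times_iff cong: conj_cong)
  with R N show ?thesis by (simp add: Let_def G_def g_def)
qed

end
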